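(* For any monotone property $P$ of boxes and any finite family $\mathcal{F}$ of boxes in $\mathbb{R}^d$, if the intersection of every subfamily of $\mathcal{F}$ of size $2d$ has property $P$, then the intersection of all the members of $\mathcal{F}$ has property $P$.
   Context: A box in $\mathbb{R}^d$ is an axis-parallel box, i.e. a set of the form $[a_1,b_1]\times\cdots\times[a_d,b_d]$ (an intersection of $2d$ closed coordinate halfspaces, one for each direction $\pm e_i$); degenerate boxes and the empty set are allowed, so that an intersection of boxes is a box. A property $P$ of boxes (a class of boxes) is monotone if $B\in P$ and $B\subseteq C$ imply $C\in P$ for all boxes $B,C$.
   Formalization: For a family with fewer than 2d members, which has no subfamily of size 2d (so the literal claim fails, e.g. for the empty property), the hypothesis is read as saying that the intersection of the whole family has property P. *)

theory Defs
  imports "HOL-Analysis.Analysis"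
begin

(* cbox a b is empty as soon as b $ i < a $ i for some i, and it is degenerate if a $ i = b $ i
   for some i; so both the empty set and degenerate boxes are boxes here. *)
definition boxes :: "(real ^ 'n) set set"
  where "boxes = {B. \<exists>a b. B = cbox a b}"

(* A property of boxes is identified with the class of boxes that have it. *)
definition monotone_box_property :: "(real ^ 'n) set set \<Rightarrow> bool"
  where "monotone_box_property P \<longleftrightarrow>
    P \<subseteq> boxes \<and> (\<forall>B\<in>boxes. \<forall>C\<in>boxes. B \<in> P \<longrightarrow> B \<subseteq> C \<longrightarrow> C \<in> P)"

end

theory Submission imports Defs begin

text \<open>A box is cut out by \<open>2d\<close> coordinate halfspaces, one for each direction \<open>\<plusminus>e\<^sub>k\<close>. Among finitely many
  parallel halfspaces facing the same way, the smallest one is contained in all the others. Hence an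
  intersection of finitely many boxes is already the intersection of the at most \<open>2d\<close> boxes that
  supply the tightest bound in some direction: the largest lower end or the smallest upper end of
  some coordinate (\<open>few_boxes_determine_Inter\<close>). The argument concerns only the bounds, so it does
  not matter whether the boxes, or their intersection, are empty. Further members of the family can
  be added to these boxes without changing the intersection, up to the size required by the
  hypothesis on \<open>P\<close>.\<close>

text \<open>Each coordinate \<open>k\<close> contributes one box \<open>l k\<close> with the largest \<open>k\<close>-th lower end and one box \<open>u k\<close>
  with the smallest \<open>k\<close>-th upper end. A point in these boxes satisfies the strictest of the bounds that
  the family imposes on each coordinate, hence all of them. One box may be chosen several times, which
  is why the cardinality is only bounded.\<close>

lemma few_boxes_determine_Inter:
  fixes F :: "'i \<Rightarrow> (real ^ 'n) set"
  assumes "finite I" "I \<noteq> {}" and boxes: "\<And>i. i \<in> I \<Longrightarrow> F i \<in> boxes"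
  obtains J where "J \<subseteq> I" "card J \<le> 2 * CARD('n)" "(\<Inter>i\<in>J. F i) = (\<Inter>i\<in>I. F i)"
proof -
  have "\<forall>i\<in>I. \<exists>a b. F i = cbox a b"
    using boxes by (simp add: boxes_def)
  then obtain a b where F: "\<And>i. i \<in> I \<Longrightarrow> F i = cbox (a i) (b i)"
    unfolding bchoice_iff by blast
  have "\<forall>k. \<exists>i. i \<in> I \<and> (\<forall>j\<in>I. a j $ k \<le> a i $ k)"
  proof
    fix k
    obtain i where "i \<in> I" "(MAX j\<in>I. a j $ k) = a i $ k"
      by (rule obtains_MAX[OF assms(1,2)])
    moreover have "a j $ k \<le> (MAX j\<in>I. a j $ k)" if "j \<in> I" for j
      using that assms(1) by (intro Max_ge) simp_all
    ultimately show "\<exists>i. i \<in> I \<and> (\<forall>j\<in>I. a j $ k \<le> a i $ k)" by auto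
  qed
  from choice[OF this] obtain l where l: "\<And>k. l k \<in> I" "\<And>k j. j \<in> I \<Longrightarrow> a j $ k \<le> a (l k) $ k"
    by blast
  have "\<forall>k. \<exists>i. i \<in> I \<and> (\<forall>j\<in>I. b i $ k \<le> b j $ k)"
  proof
    fix k
    obtain i where "i \<in> I" "(MIN j\<in>I. b j $ k) = b i $ k"
      by (rule obtains_MIN[OF assms(1,2)])
    moreover have "(MIN j\<in>I. b j $ k) \<le> b j $ k" if "j \<in> I" for j
      using that assms(1) by (intro Min_le) simp_all
    ultimately show "\<exists>i. i \<in> I \<and> (\<forall>j\<in>I. b i $ k \<le> b j $ k)" by auto
  qed
  from choice[OF this] obtain u where u: "\<And>k. u k \<in> I" "\<And>k j. j \<in> I \<Longrightarrow> b (u k) $ k \<le> b j $ k"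
    by blast
  let ?J = "range l \<union> range u"
  have "?J \<subseteq> I"
    using l(1) u(1) by blast
  moreover have "card ?J \<le> 2 * CARD('n)"
    using card_Un_le[of "range l" "range u"] card_image_le[of UNIV l] card_image_le[of UNIV u]
    by simp
  moreover have "(\<Inter>i\<in>?J. F i) = (\<Inter>i\<in>I. F i)"
  proof
    show "(\<Inter>i\<in>?J. F i) \<subseteq> (\<Inter>i\<in>I. F i)"
    proof
      fix x assume x: "x \<in> (\<Inter>i\<in>?J. F i)"
      have "a i $ k \<le> x $ k \<and> x $ k \<le> b i $ k" if "i \<in> I" for i k
      proof -
        have "x \<in> cbox (a (l k)) (b (l k))" "x \<in> cbox (a (u k)) (b (u k))"
          using x unfolding F[OF l(1), symmetric] F[OF u(1), symmetric] by blast+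
        then have "a (l k) $ k \<le> x $ k" "x $ k \<le> b (u k) $ k"
          by (simp_all add: mem_box_cart)
        then show ?thesis
          using l(2)[OF that, of k] u(2)[OF that, of k] by linarith
      qed
      then show "x \<in> (\<Inter>i\<in>I. F i)"
        by (simp add: F mem_box_cart)
    qed
  qed (use \<open>?J \<subseteq> I\<close> in blast)
  ultimately show thesis
    by (rule that)
qed

(* Families are indexed, so members may be repeated; a set of boxes is the case F = id.
   If the family has at least 2d members, the subfamilies in the hypothesis are exactly those of
   size 2d.  A smaller family has none of that size, and the claim would be false for it (take
   the empty property); the min makes the hypothesis then refer to the whole family. *)
theorem corollary1p2:
  fixes P :: "(real ^ 'n) set set"
    and F :: "'i \<Rightarrow> (real ^ 'n) set"
    and I :: "'i set"
  assumes "monotone_box_property P"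
    and "finite I"
    and "\<And>i. i \<in> I \<Longrightarrow> F i \<in> boxes"
    and "\<And>J. J \<subseteq> I \<Longrightarrow> card J = min (2 * CARD('n)) (card I) \<Longrightarrow> (\<Inter>i\<in>J. F i) \<in> P"
  shows "(\<Inter>i\<in>I. F i) \<in> P"
proof (cases "I = {}")
  case True
  then show ?thesis
    using assms(4)[of "{}"] by simp
next
  case False
  obtain J where J: "J \<subseteq> I" "card J \<le> 2 * CARD('n)" "(\<Inter>i\<in>J. F i) = (\<Inter>i\<in>I. F i)"
    by (rule few_boxes_determine_Inter[OF assms(2) False assms(3)])
  have card_J: "card J \<le> min (2 * CARD('n)) (card I)"
    using J(1,2) assms(2) by (simp add: card_mono)
  obtain K where K: "J \<subseteq> K" "K \<subseteq> I" "card K = min (2 * CARD('n)) (card I)"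
    using exists_subset_between[OF card_J min.cobounded2 J(1) assms(2)] by blast
  have "(\<Inter>i\<in>K. F i) = (\<Inter>i\<in>I. F i)"
    using J(3) K(1,2) by blast
  with assms(4)[OF K(2,3)] show ?thesis
    by simp
qed

end
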